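(* The recursively defined rectangle family $P_2$ satisfies $$\frac{\alpha^*(P_2)}{\nu(P_2)}\ge\frac{137}{64}>2 .$$
   Context: All rectangles are closed and axis-parallel. For a finite rectangle family $\mathcal R$, $\nu(\mathcal R)$ is the maximum size of a pairwise disjoint subfamily, and $G(\mathcal R)$ is the intersection graph (vertices are the rectangles, edges join intersecting pairs). The clique relaxation value is $$\alpha^*(\mathcal R)=\alpha^*(G(\mathcal R))=\max\Big\{\sum_{v}x_v:\ x_v\ge 0,\ \sum_{v\in K}x_v\le 1\text{ for every clique }K\text{ of }G(\mathcal R)\Big\}.$$ Construction of $P_r$. Write $[q]=\{0,1,\dots,q-1\}$. Each $P_r$ is a finite rectangle family drawn in a square $[0,L]^2$ together with $q$ vertical marker lines $x=\xi_0,\dots,x=\xi_{q-1}$ and $q$ horizontal marker lines $y=\eta_0,\dots,y=\eta_{q-1}$ (in increasing order). Base: $P_0$ has $L=30$, $q=4$, $\xi=(3,11,19,27)$, $\eta=(3,11,21,27)$ and consists of the eight rectangles $T=[0,30]\times[26,28]$, $U_L=[0,16]\times[20,22]$, $U_R=[14,30]\times[20,22]$, $C_0=[0,8]\times[2,10]$, $C_1=[6,16]\times[8,14]$, $C_2=[14,24]\times[8,14]$, $C_3=[22,30]\times[2,12]$, $Q=[6,24]\times[0,4]$. Crossbar step: given $P$ with data $L,q,\xi,\eta$, put $M=L+1$, and for $R=[x_1,x_2]\times[y_1,y_2]\in P$ and $i,j\in[q]$ let $$H_i(R)=[Mx_1,Mx_2]\times[M\xi_i+y_1,M\xi_i+y_2],\qquad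 V_j(R)=[M\xi_j+y_1,M\xi_j+y_2]\times[Mx_1,Mx_2].$$ $C(P)$ is the family of all $H_i(R)$ and $V_j(R)$ with $R\in P$, $i,j\in[q]$. It is drawn in $[0,ML+L]^2$, with $q^2$ vertical markers $\xi'_{(j,t)}=M\xi_j+\eta_t$ and $q^2$ horizontal markers $\eta'_{(i,t)}=M\xi_i+\eta_t$, indexed by $[q]\times[q]$ and ordered lexicographically. Recursion: $P_{r+1}=C(P_r)$ for $r\ge0$. *)

theory Defs
  imports "HOL-Analysis.Analysis"
begin

section \<open>Rectangles, packing number and clique relaxation\<close>

text \<open>\<open>Rect x1 x2 y1 y2\<close> is a name for the closed box \<open>[x1,x2] \<times> [y1,y2]\<close>. The coordinates are kept
  as data because the construction below manipulates them.\<close>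

datatype rect = Rect real real real real

fun region :: "rect \<Rightarrow> (real \<times> real) set" where
  "region (Rect x1 x2 y1 y2) = {x1..x2} \<times> {y1..y2}"

definition pairwise_disjoint :: "rect set \<Rightarrow> bool" where
  "pairwise_disjoint S \<longleftrightarrow> (\<forall>R\<in>S. \<forall>R'\<in>S. R \<noteq> R' \<longrightarrow> region R \<inter> region R' = {})"

definition packing_number :: "rect set \<Rightarrow> nat" where
  "packing_number F = Max {card S | S. S \<subseteq> F \<and> pairwise_disjoint S}"

type_synonym 'a ugraph = "'a set \<times> 'a set set"

definition intersection_graph :: "rect set \<Rightarrow> rect ugraph" where
  "intersection_graph F =
     (F, {{R, R'} | R R'. R \<in> F \<and> R' \<in> F \<and> R \<noteq> R' \<and> region R \<inter> region R' \<noteq> {}})"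

definition is_clique :: "'a ugraph \<Rightarrow> 'a set \<Rightarrow> bool" where
  "is_clique G K \<longleftrightarrow> K \<subseteq> fst G \<and> (\<forall>u\<in>K. \<forall>v\<in>K. u \<noteq> v \<longrightarrow> {u, v} \<in> snd G)"

definition clique_feasible :: "'a ugraph \<Rightarrow> ('a \<Rightarrow> real) \<Rightarrow> bool" where
  "clique_feasible G x \<longleftrightarrow>
     (\<forall>v\<in>fst G. 0 \<le> x v) \<and> (\<forall>K. is_clique G K \<longrightarrow> (\<Sum>v\<in>K. x v) \<le> 1)"

text \<open>For a finite graph the supremum is attained; see \<open>alpha_star_is_max\<close> below.\<close>

definition alpha_star :: "'a ugraph \<Rightarrow> real" where
  "alpha_star G = Sup {\<Sum>v\<in>fst G. x v | x. clique_feasible G x}"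

lemma alpha_star_is_max:
  fixes G :: "'a ugraph"
  assumes fin: "finite (fst G)"
  shows "\<exists>x. clique_feasible G x \<and> (\<Sum>v\<in>fst G. x v) = alpha_star G"
    and "clique_feasible G y \<Longrightarrow> (\<Sum>v\<in>fst G. y v) \<le> alpha_star G"
proof -
  let ?V = "fst G"
  let ?C = "PiE UNIV (\<lambda>v. if v \<in> ?V then {0..1} else {0}) :: ('a \<Rightarrow> real) set"
  let ?H = "\<lambda>K. {x :: 'a \<Rightarrow> real. is_clique G K \<longrightarrow> (\<Sum>v\<in>K. x v) \<le> 1}"
  let ?S = "?C \<inter> (\<Inter>K. ?H K)"
  have cont: "continuous_on UNIV (\<lambda>x :: 'a \<Rightarrow> real. \<Sum>v\<in>K. x v)" for K
    by (intro continuous_on_sum continuous_on_product_coordinates)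
  have "closed (?H K)" for K
  proof (cases "is_clique G K")
    case True
    then show ?thesis
      using closed_Collect_le[OF cont[of K] continuous_on_const[of UNIV 1]] by simp
  qed simp
  then have "closed (\<Inter>K. ?H K)" by (intro closed_INT ballI)
  moreover have "compact ?C"
  proof -
    have "compactin (product_topology (\<lambda>_. euclidean) UNIV) ?C"
      unfolding compactin_PiE by (intro disjI2 ballI) simp
    then show ?thesis
      by (simp only: euclidean_product_topology compactin_euclidean_iff)
  qed
  ultimately have comp: "compact ?S"
    by (rule compact_Int_closed[rotated])
  have S_iff: "z \<in> ?S \<longleftrightarrow> (\<forall>v. if v \<in> ?V then 0 \<le> z v \<and> z v \<le> 1 else z v = 0) \<and>
      (\<forall>K. is_clique G K \<longrightarrow> (\<Sum>v\<in>K. z v) \<le> 1)" for z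
  proof -
    have "z v \<in> (if v \<in> ?V then {0..1} else {0}) \<longleftrightarrow>
        (if v \<in> ?V then 0 \<le> z v \<and> z v \<le> 1 else z v = 0)" for v
      by simp
    then show ?thesis by (simp only: Int_iff PiE_iff INT_iff mem_Collect_eq extensional_UNIV UNIV_I) simp
  qed
  have "(\<lambda>_. 0) \<in> ?S" unfolding S_iff by simp
  then have "?S \<noteq> {}" by (rule ex_in_conv[THEN iffD1, OF exI])
  from continuous_attains_sup[OF comp this continuous_on_subset[OF cont subset_UNIV], of ?V]
  obtain x where x: "x \<in> ?S" and
    xmax: "\<And>y. y \<in> ?S \<Longrightarrow> (\<Sum>v\<in>?V. y v) \<le> (\<Sum>v\<in>?V. x v)"
    by (elim bexE) (rule that, assumption, erule bspec)
  have feas: "clique_feasible G x"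
    using x unfolding S_iff clique_feasible_def by metis
  have le: "(\<Sum>v\<in>?V. y v) \<le> (\<Sum>v\<in>?V. x v)" if y: "clique_feasible G y" for y
  proof -
    let ?z = "\<lambda>v. if v \<in> ?V then y v else 0"
    have "y v \<le> 1" if "v \<in> ?V" for v
    proof -
      have "is_clique G {v}" using that by (simp add: is_clique_def)
      then have "(\<Sum>v\<in>{v}. y v) \<le> 1" using y unfolding clique_feasible_def by blast
      then show ?thesis by simp
    qed
    moreover have "(\<Sum>v\<in>K. ?z v) \<le> 1" if K: "is_clique G K" for K
    proof -
      have "(\<Sum>v\<in>K. ?z v) = (\<Sum>v\<in>K. y v)"
        using K by (intro sum.cong) (auto simp: is_clique_def)
      then show ?thesis using y K by (simp add: clique_feasible_def)
    qed
    ultimately have "?z \<in> ?S"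
      using y unfolding S_iff clique_feasible_def by simp
    from xmax[OF this] show ?thesis by simp
  qed
  have "alpha_star G = (\<Sum>v\<in>?V. x v)"
    unfolding alpha_star_def using feas le by (intro cSup_eq_maximum) auto
  then show "\<exists>x. clique_feasible G x \<and> (\<Sum>v\<in>?V. x v) = alpha_star G"
    and "clique_feasible G y \<Longrightarrow> (\<Sum>v\<in>?V. y v) \<le> alpha_star G"
    using feas le by auto
qed

section \<open>The crossbar construction\<close>

text \<open>A family drawn in \<open>[0, side]\<^sup>2\<close>. The marker lists are \<open>(\<xi>\<^sub>0, \<dots>, \<xi>\<^sub>q\<^sub>-\<^sub>1)\<close>
  and \<open>(\<eta>\<^sub>0, \<dots>, \<eta>\<^sub>q\<^sub>-\<^sub>1)\<close>, so \<open>q\<close> is their common length.\<close>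

record drawing =
  rects :: "rect set"
  side :: real
  xmarks :: "real list"
  ymarks :: "real list"

definition base_drawing :: drawing where
  "base_drawing = \<lparr>
     rects = {Rect 0 30 26 28, Rect 0 16 20 22, Rect 14 30 20 22, Rect 0 8 2 10,
              Rect 6 16 8 14, Rect 14 24 8 14, Rect 22 30 2 12, Rect 6 24 0 4},
     side = 30,
     xmarks = [3, 11, 19, 27],
     ymarks = [3, 11, 21, 27]\<rparr>"

text \<open>In the next two functions \<open>m\<close> is the scaling factor \<open>M\<close> and \<open>a\<close> is the marker \<open>\<xi>\<^sub>i\<close> (resp. \<open>\<xi>\<^sub>j\<close>).\<close>

fun hcopy :: "real \<Rightarrow> real \<Rightarrow> rect \<Rightarrow> rect" where
  "hcopy m a (Rect x1 x2 y1 y2) = Rect (m * x1) (m * x2) (m * a + y1) (m * a + y2)"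

fun vcopy :: "real \<Rightarrow> real \<Rightarrow> rect \<Rightarrow> rect" where
  "vcopy m a (Rect x1 x2 y1 y2) = Rect (m * a + y1) (m * a + y2) (m * x1) (m * x2)"

text \<open>The list comprehensions enumerate the index pairs in lexicographic order. Both new marker
  lists are given by the same formula, \<open>M\<xi> + \<eta>\<close>; horizontal copies, too, are placed at the
  \<open>\<xi>\<close>-markers.\<close>

definition crossbar :: "drawing \<Rightarrow> drawing" where
  "crossbar D = (let m = side D + 1; \<xi> = xmarks D; \<eta> = ymarks D in \<lparr>
     rects = {hcopy m (\<xi> ! i) R | i R. i < length \<xi> \<and> R \<in> rects D} \<union>
             {vcopy m (\<xi> ! j) R | j R. j < length \<xi> \<and> R \<in> rects D},
     side = m * side D + side D,
     xmarks = [m * a + b. a \<leftarrow> \<xi>, b \<leftarrow> \<eta>],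
     ymarks = [m * a + b. a \<leftarrow> \<xi>, b \<leftarrow> \<eta>]\<rparr>)"

primrec drawing_seq :: "nat \<Rightarrow> drawing" where
  "drawing_seq 0 = base_drawing"
| "drawing_seq (Suc r) = crossbar (drawing_seq r)"

definition rect_family :: "nat \<Rightarrow> rect set" where
  "rect_family r = rects (drawing_seq r)"

lemma finite_rect_family: "finite (rect_family r)"
  unfolding rect_family_def
proof (induction r)
  case (Suc r)
  have "finite {f i R | i R. i < n \<and> R \<in> rects (drawing_seq r)}"
    for f :: "nat \<Rightarrow> rect \<Rightarrow> rect" and n :: nat
    using finite_image_set2[of "\<lambda>i. i < n" "\<lambda>R. R \<in> rects (drawing_seq r)" f] Suc by simp
  then show ?case
    by (simp add: crossbar_def Let_def)
qed (simp add: base_drawing_def)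

end

theory Submission
  imports Defs
begin

text \<open>
  The ratio is \<open>548 / 256\<close>: packings of \<open>P\<^sub>2\<close> have at most \<open>256\<close> members, and there is a feasible
  weighting of total \<open>548\<close>. Both halves rest on one fact about \<open>C(P)\<close>. Since rectangles and markers
  have integer coordinates, lie in \<open>[0, L]\<close>, and are scaled by \<open>M > L\<close>, copies in different rows (or
  different columns) are disjoint, copies in the same row overlap as in \<open>P\<close>, and the copy of \<open>R\<close> in
  row \<open>a\<close> meets the copy of \<open>R'\<close> in column \<open>b\<close> exactly if \<open>R\<close> meets the vertical marker \<open>b\<close> of \<open>P\<close>
  and \<open>R'\<close> meets the vertical marker \<open>a\<close>.

  Upper bound on packings. A packing of \<open>P\<^sub>0\<close> never has more members than there are vertical markers
  meeting it, and likewise for horizontal markers. The crossbar step preserves this property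
  (\<open>marker_bounded_crossbar\<close>). The rows and columns of a packing of \<open>C(P)\<close> are packings of \<open>P\<close>, and
  each cell \<open>(a, b)\<close> of the \<open>q \<times> q\<close> grid can be used by row \<open>a\<close> or by column \<open>b\<close> but not by both.
  The cells of the columns that some row uses therefore pay for all horizontal copies and for the
  vertical copies in these columns, and each such column has \<open>q\<close> new markers, as many as cells. In the
  other columns the horizontal markers of \<open>P\<close> pay for the vertical copies. So a packing of
  \<open>P\<^sub>2\<close> has at most as many members as \<open>P\<^sub>2\<close> has vertical markers, namely \<open>256\<close>.

  Lower bound on the relaxation. A clique of \<open>C(P)\<close> lies in one row \<open>a\<close> and one column \<open>b\<close>, and if it
  uses both, then its row part meets the marker \<open>b\<close> and its column part meets the marker \<open>a\<close>. So
  weights \<open>w\<^sub>a\<close> on \<open>P\<close>, used both in row \<open>a\<close> and in column \<open>a\<close>, are feasible as soon as cliques of \<open>P\<close>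
  have weight at most \<open>1\<close> and those on the marker \<open>b\<close> have \<open>w\<^sub>a\<close>-weight at most \<open>cap a b\<close>, where
  \<open>cap a b + cap b a \<le> 1\<close> (\<open>alpha_star_crossbar_ge\<close>). Splitting every cell evenly, with
  \<open>cap = 1/2\<close>, gains only the ratio \<open>2\<close>. For \<open>P = P\<^sub>1\<close> the markers are \<open>31 \<xi>\<^sub>i + \<eta>\<^sub>t\<close>, and it pays to
  let the share depend on the heights \<open>\<eta>\<^sub>t\<close> of both markers: with the heights \<open>3, 11, 21, 27\<close> as row and
  column labels, \<open>cap\<close> is
  \<open>(1/2, 1/2, 1/4, 1/4)\<close>, \<open>(1/2, 1/2, 1/4, 1/4)\<close>, \<open>(3/4, 3/4, 1/2, 3/8)\<close>, \<open>(3/4, 3/4, 5/8, 1/2)\<close>.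
  Compared with the total \<open>16\<close> of a line under the even split, the lines of the two low heights lose
  \<open>3\<close> each, and those of the heights \<open>21\<close> and \<open>27\<close> gain \<open>4.5\<close> and \<open>6\<close>.
  The cliques of \<open>P\<^sub>1\<close> are controlled by two features of \<open>P\<^sub>0\<close>: it is triangle free, and two
  rectangles that overlap never share a vertical marker.
\<close>

section \<open>Overlaps in a crossbar\<close>

definition meets :: "rect \<Rightarrow> rect \<Rightarrow> bool" where
  "meets R R' \<longleftrightarrow> region R \<inter> region R' \<noteq> {}"

fun xmeets :: "real \<Rightarrow> rect \<Rightarrow> bool" where
  "xmeets a (Rect x1 x2 y1 y2) \<longleftrightarrow> x1 \<le> a \<and> a \<le> x2"

fun ymeets :: "real \<Rightarrow> rect \<Rightarrow> bool" where
  "ymeets a (Rect x1 x2 y1 y2) \<longleftrightarrow> y1 \<le> a \<and> a \<le> y2"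

lemma meets_Rect:
  "meets (Rect x1 x2 y1 y2) (Rect x1' x2' y1' y2') \<longleftrightarrow>
     max x1 x1' \<le> min x2 x2' \<and> max y1 y1' \<le> min y2 y2'"
  by (auto simp: meets_def Times_Int_Times)

text \<open>The general position that makes a crossbar combinatorial. Integer coordinates prevent the small
  shifts inside a scaled line from changing the order of coordinates, and no marker may run along an
  edge, since such a contact would disappear or persist in the crossbar depending on the shift.\<close>

definition well_placed :: "drawing \<Rightarrow> bool" where
  "well_placed D \<longleftrightarrow> side D \<in> \<int> \<and>
     (\<forall>x1 x2 y1 y2. Rect x1 x2 y1 y2 \<in> rects D \<longrightarrow>
        {x1, x2, y1, y2} \<subseteq> \<int> \<and>
        0 \<le> x1 \<and> x1 < x2 \<and> x2 \<le> side D \<and> 0 \<le> y1 \<and> y1 < y2 \<and> y2 \<le> side D \<and>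
        {x1, x2} \<inter> set (xmarks D) = {} \<and> {y1, y2} \<inter> set (ymarks D) = {}) \<and>
     set (xmarks D) \<subseteq> \<int> \<inter> {0<..<side D} \<and> set (ymarks D) \<subseteq> \<int> \<inter> {0<..<side D}"

text \<open>Scaled coordinates are compared lexicographically: \<open>x\<close> and \<open>a\<close> are leading digits to the base
  \<open>m\<close>, and \<open>s\<close> and \<open>t\<close> are the last digits. Every overlap question in a crossbar reduces to this.\<close>

lemma scaled_le_iff:
  fixes m :: real
  assumes "x \<in> \<int>" "a \<in> \<int>" "0 \<le> s" "s < m" "0 \<le> t" "t < m"
  shows "m * x + s \<le> m * a + t \<longleftrightarrow> x < a \<or> x = a \<and> s \<le> t"
proof -
  obtain i j :: int where ij: "x = of_int i" "a = of_int j"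
    using assms by (auto elim!: Ints_cases)
  have strict: "m * of_int k + u < m * of_int l + v"
    if "k < l" "u < m" "0 \<le> v" "0 < m" for k l :: int and u v :: real
  proof -
    have "of_int k + 1 \<le> (of_int l :: real)" using that(1) by linarith
    then have "m * (of_int k + 1) \<le> m * of_int l"
      using that by (intro mult_left_mono) auto
    then show ?thesis using that by (simp add: algebra_simps)
  qed
  show ?thesis
    using strict[of i j s t] strict[of j i t s] assms ij
    by (cases i j rule: linorder_cases) auto
qed

lemma scaled_eq_iff:
  fixes m :: real
  assumes "x \<in> \<int>" "a \<in> \<int>" "0 \<le> s" "s < m" "0 \<le> t" "t < m"
  shows "m * x + s = m * a + t \<longleftrightarrow> x = a \<and> s = t"
  using scaled_le_iff[OF assms] scaled_le_iff[of a x t m s] assms by auto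

locale placed_drawing =
  fixes D :: drawing and m :: real
  assumes placed: "well_placed D"
  defines m_def: "m \<equiv> side D + 1"
begin

abbreviation "X \<equiv> set (xmarks D)"
abbreviation "Y \<equiv> set (ymarks D)"

lemma rect_bounds:
  assumes "Rect x1 x2 y1 y2 \<in> rects D"
  shows "x1 \<in> \<int>" "x2 \<in> \<int>" "y1 \<in> \<int>" "y2 \<in> \<int>"
    "0 \<le> x1" "x1 < x2" "x2 < m" "0 \<le> y1" "y1 < y2" "y2 < m"
    "x1 \<notin> X" "x2 \<notin> X" "y1 \<notin> Y" "y2 \<notin> Y" "x2 \<le> side D" "y2 \<le> side D"
proof -
  have "{x1, x2, y1, y2} \<subseteq> \<int> \<and>
      0 \<le> x1 \<and> x1 < x2 \<and> x2 \<le> side D \<and> 0 \<le> y1 \<and> y1 < y2 \<and> y2 \<le> side D \<and>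
      {x1, x2} \<inter> X = {} \<and> {y1, y2} \<inter> Y = {}"
    using placed assms unfolding well_placed_def by blast
  then show "x1 \<in> \<int>" "x2 \<in> \<int>" "y1 \<in> \<int>" "y2 \<in> \<int>"
    "0 \<le> x1" "x1 < x2" "x2 < m" "0 \<le> y1" "y1 < y2" "y2 < m"
    "x1 \<notin> X" "x2 \<notin> X" "y1 \<notin> Y" "y2 \<notin> Y" "x2 \<le> side D" "y2 \<le> side D"
    by (simp_all add: m_def)
qed

lemma mark_bounds:
  assumes "a \<in> X \<union> Y" shows "a \<in> \<int>" "0 < a" "a < side D" "a < m"
proof -
  have "X \<union> Y \<subseteq> \<int> \<inter> {0<..<side D}"
    using placed unfolding well_placed_def by (elim conjE) (rule Un_least)
  then have "a \<in> \<int> \<inter> {0<..<side D}" using assms by (rule subsetD)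
  then show "a \<in> \<int>" "0 < a" "a < side D" "a < m" by (simp_all add: m_def)
qed

lemmas xmark_bounds = mark_bounds[OF UnI1]
lemmas ymark_bounds = mark_bounds[OF UnI2]

lemma side_bounds: "side D \<in> \<int>" "m \<in> \<int>" "a \<in> X \<Longrightarrow> 0 < m"
proof -
  show "side D \<in> \<int>" using placed unfolding well_placed_def by (elim conjE)
  then show "m \<in> \<int>" unfolding m_def by simp
  show "0 < m" if "a \<in> X" using xmark_bounds[OF that] by linarith
qed

lemma scaled_marks [simp]:
  "x \<in> \<int> \<Longrightarrow> a \<in> \<int> \<Longrightarrow> 0 \<le> t \<Longrightarrow> t < m \<Longrightarrow> m * x \<le> m * a + t \<longleftrightarrow> x \<le> a"
  "x \<in> \<int> \<Longrightarrow> a \<in> \<int> \<Longrightarrow> 0 \<le> t \<Longrightarrow> t < m \<Longrightarrow> x \<noteq> a \<Longrightarrow> m * a + t \<le> m * x \<longleftrightarrow> a \<le> x"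
  using scaled_le_iff[of x a 0 m t] scaled_le_iff[of a x t m 0] by auto

lemma meets_hcopy_hcopy:
  assumes "R \<in> rects D" "R' \<in> rects D" "a \<in> X" "a' \<in> X"
  shows "meets (hcopy m a R) (hcopy m a' R') \<longleftrightarrow> a = a' \<and> meets R R'"
proof -
  obtain x1 x2 y1 y2 x1' x2' y1' y2'
    where [simp]: "R = Rect x1 x2 y1 y2" "R' = Rect x1' x2' y1' y2'"
    by (cases R, cases R')
  note b = rect_bounds[of x1 x2 y1 y2] rect_bounds[of x1' x2' y1' y2']
    xmark_bounds[OF assms(3)] xmark_bounds[OF assms(4)]
  have "0 < m" using b assms by simp
  moreover have "m * a + y1 \<le> m * a' + y2' \<longleftrightarrow> a < a' \<or> a = a' \<and> y1 \<le> y2'"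
    "m * a' + y1' \<le> m * a + y2 \<longleftrightarrow> a' < a \<or> a' = a \<and> y1' \<le> y2"
    using b assms by (intro scaled_le_iff; simp)+
  ultimately show ?thesis
    using b assms by (auto simp: meets_Rect)
qed

text \<open>The horizontal copy extends to the exact positions \<open>m * x1\<close> and \<open>m * x2\<close>, whereas the vertical copy
  occupies a strip inside the interval from \<open>m * b\<close> to \<open>m * (b + 1)\<close>. For integers the strip lies
  between the two positions exactly if \<open>x1 \<le> b < x2\<close>, and general position excludes \<open>x2 = b\<close>.\<close>

lemma meets_hcopy_vcopy:
  assumes "R \<in> rects D" "R' \<in> rects D" "a \<in> X" "b \<in> X"
  shows "meets (hcopy m a R) (vcopy m b R') \<longleftrightarrow> xmeets b R \<and> xmeets a R'"
proof -
  obtain x1 x2 y1 y2 x1' x2' y1' y2'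
    where [simp]: "R = Rect x1 x2 y1 y2" "R' = Rect x1' x2' y1' y2'"
    by (cases R, cases R')
  note b = rect_bounds[of x1 x2 y1 y2] rect_bounds[of x1' x2' y1' y2']
    xmark_bounds[OF assms(3)] xmark_bounds[OF assms(4)]
  have "x2 \<noteq> b" "x2' \<noteq> a" using b assms by auto
  moreover have "0 < m" using b assms by simp
  ultimately show ?thesis
    using b assms by (auto simp: meets_Rect)
qed

lemma xmeets_hcopy:
  assumes "R \<in> rects D" "b \<in> X" "t \<in> Y"
  shows "xmeets (m * b + t) (hcopy m a R) \<longleftrightarrow> xmeets b R"
proof -
  obtain x1 x2 y1 y2 where [simp]: "R = Rect x1 x2 y1 y2" by (cases R)
  note b = rect_bounds[of x1 x2 y1 y2] xmark_bounds[OF assms(2)] ymark_bounds[OF assms(3)]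
  have "x2 \<noteq> b" using b assms by auto
  then show ?thesis using b assms by simp
qed

lemma xmeets_vcopy:
  assumes "R \<in> rects D" "a \<in> X" "b \<in> X" "t \<in> Y"
  shows "xmeets (m * b + t) (vcopy m a R) \<longleftrightarrow> a = b \<and> ymeets t R"
proof -
  obtain x1 x2 y1 y2 where [simp]: "R = Rect x1 x2 y1 y2" by (cases R)
  note b = rect_bounds[of x1 x2 y1 y2] xmark_bounds[OF assms(2)] xmark_bounds[OF assms(3)]
    ymark_bounds[OF assms(4)]
  have "m * a + y1 \<le> m * b + t \<longleftrightarrow> a < b \<or> a = b \<and> y1 \<le> t"
    "m * b + t \<le> m * a + y2 \<longleftrightarrow> b < a \<or> b = a \<and> t \<le> y2"
    using b assms by (intro scaled_le_iff; simp)+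
  then show ?thesis by auto
qed

end

text \<open>Reflection in the diagonal exchanges the two kinds of copies and fixes every crossbar, so
  statements about vertical copies or horizontal markers follow from their mirror images.\<close>

fun flip :: "rect \<Rightarrow> rect" where
  "flip (Rect x1 x2 y1 y2) = Rect y1 y2 x1 x2"

lemma flip_simps [simp]:
  "flip (flip R) = R" "flip (hcopy m a R) = vcopy m a R" "flip (vcopy m a R) = hcopy m a R"
  "meets (flip R) (flip R') = meets R R'" "xmeets a (flip R) = ymeets a R"
  by (cases R; cases R'; auto simp: meets_Rect)+

lemma (in placed_drawing) meets_vcopy_vcopy:
  assumes "R \<in> rects D" "R' \<in> rects D" "a \<in> X" "a' \<in> X"
  shows "meets (vcopy m a R) (vcopy m a' R') \<longleftrightarrow> a = a' \<and> meets R R'"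
  using meets_hcopy_hcopy[OF assms] flip_simps(4)[of "hcopy m a R" "hcopy m a' R'"] by simp

section \<open>The crossbar as an indexed family\<close>

text \<open>A single injective labelling of all members of a crossbar. A weight on the crossbar can then be
  given as a function of the label instead of the coordinates.\<close>

fun copy :: "real \<Rightarrow> bool \<times> real \<times> rect \<Rightarrow> rect" where
  "copy m (hor, a, R) = (if hor then hcopy m a R else vcopy m a R)"

lemma crossbar_simps:
  defines "m \<equiv> \<lambda>D. side D + 1"
  shows "rects (crossbar D) = copy (m D) ` (UNIV \<times> set (xmarks D) \<times> rects D)"
    and "set (xmarks (crossbar D)) = (\<lambda>(a, t). m D * a + t) ` (set (xmarks D) \<times> set (ymarks D))"
    and "ymarks (crossbar D) = xmarks (crossbar D)"
    and "side (crossbar D) = m D * side D + side D"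
proof -
  have "rects (crossbar D) = {hcopy (m D) a R | a R. a \<in> set (xmarks D) \<and> R \<in> rects D} \<union>
      {vcopy (m D) a R | a R. a \<in> set (xmarks D) \<and> R \<in> rects D}"
    unfolding crossbar_def Let_def m_def by (simp add: in_set_conv_nth) blast
  also have "\<dots> = copy (m D) ` (UNIV \<times> set (xmarks D) \<times> rects D)"
    by (simp add: set_eq_iff image_iff Bex_def ex_bool_eq) blast
  finally show "rects (crossbar D) = copy (m D) ` (UNIV \<times> set (xmarks D) \<times> rects D)" .
qed (auto simp: crossbar_def Let_def m_def)

lemma flip_crossbar: "R \<in> rects (crossbar D) \<Longrightarrow> flip R \<in> rects (crossbar D)"
proof -
  assume "R \<in> rects (crossbar D)"
  then obtain hor a S where "R = copy (side D + 1) (hor, a, S)" "a \<in> set (xmarks D)" "S \<in> rects D"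
    unfolding crossbar_simps by auto
  then have "flip R = copy (side D + 1) (\<not> hor, a, S)" "(\<not> hor, a, S) \<in> UNIV \<times> set (xmarks D) \<times> rects D"
    by auto
  then show "flip R \<in> rects (crossbar D)"
    unfolding crossbar_simps by (metis imageI)
qed

context placed_drawing begin

lemma crossbar_rects: "rects (crossbar D) = copy m ` (UNIV \<times> X \<times> rects D)"
  unfolding m_def by (rule crossbar_simps)

lemma crossbar_xmarks: "set (xmarks (crossbar D)) = (\<lambda>(a, t). m * a + t) ` (X \<times> Y)"
  unfolding m_def by (rule crossbar_simps)

lemma crossbar_side: "side (crossbar D) = m * side D + side D"
  unfolding m_def by (rule crossbar_simps)

lemma inj_on_marks: "inj_on (\<lambda>(a, t). m * a + t) (X \<times> Y)"
proof (rule inj_onI, clarify)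
  fix a t a' t' assume as: "a \<in> X" "t \<in> Y" "a' \<in> X" "t' \<in> Y" and eq: "m * a + t = m * a' + t'"
  show "a = a' \<and> t = t'"
    using eq xmark_bounds[OF as(1)] ymark_bounds[OF as(2)] xmark_bounds[OF as(3)]
      ymark_bounds[OF as(4)] scaled_eq_iff[of a a' t m t'] by simp
qed

lemma inj_on_copy: "inj_on (copy m) (UNIV \<times> X \<times> rects D)"
proof -
  have ne: "hcopy m a R \<noteq> vcopy m b R'"
    if "a \<in> X" "b \<in> X" "R \<in> rects D" "R' \<in> rects D" for a b R R'
  proof -
    obtain x1 x2 y1 y2 x1' x2' y1' y2'
      where R: "R = Rect x1 x2 y1 y2" "R' = Rect x1' x2' y1' y2'"
      by (cases R, cases R')
    \<comment> \<open>If they were equal, the left and the right edge would both have the leading digit \<open>b\<close>.\<close>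
    have b: "x1 \<in> \<int>" "x2 \<in> \<int>" "x1 < x2" "0 \<le> y1'" "y1' < y2'" "y2' < m" "b \<in> \<int>"
      using that R rect_bounds[of x1 x2 y1 y2] rect_bounds[of x1' x2' y1' y2'] xmark_bounds[of b]
      by simp_all
    have "m * x1 + 0 = m * b + y1' \<Longrightarrow> x1 = b" "m * x2 + 0 = m * b + y2' \<Longrightarrow> x2 = b"
      using b scaled_eq_iff[of x1 b 0 m y1'] scaled_eq_iff[of x2 b 0 m y2'] by simp_all
    then show ?thesis using R b by auto
  qed
  show ?thesis
  proof (rule inj_onI)
    fix p q assume "p \<in> UNIV \<times> X \<times> rects D" "q \<in> UNIV \<times> X \<times> rects D"
      and "copy m p = copy m q"
    then obtain o1 a1 R1 o2 a2 R2 where p: "p = (o1, a1, R1)" "q = (o2, a2, R2)"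
      and as: "a1 \<in> X" "a2 \<in> X" "R1 \<in> rects D" "R2 \<in> rects D"
      and eq: "copy m (o1, a1, R1) = copy m (o2, a2, R2)"
      by auto
    obtain x1 x2 y1 y2 x1' x2' y1' y2'
      where R: "R1 = Rect x1 x2 y1 y2" "R2 = Rect x1' x2' y1' y2'"
      by (cases R1, cases R2)
    have o: "o1 = o2"
      using eq ne[OF as(1,2,3,4)] ne[OF as(2,1,4,3)] by (auto split: if_splits)
    have b: "0 < m" "0 \<le> y1" "y1 < m" "0 \<le> y1'" "y1' < m" "a1 \<in> \<int>" "a2 \<in> \<int>"
      using rect_bounds[of x1 x2 y1 y2] rect_bounds[of x1' x2' y1' y2']
        xmark_bounds(1)[OF as(1)] xmark_bounds(1)[OF as(2)] as R by simp_all
    have "m * a1 + y1 = m * a2 + y1'"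
      using eq o R by (auto split: if_splits)
    then have "a1 = a2" using b scaled_eq_iff[of a1 a2 y1 m y1'] by simp
    then show "p = q"
      using eq o p R b by (auto split: if_splits)
  qed
qed

lemma hcopy_neq_vcopy:
  assumes "a \<in> X" "b \<in> X" "R \<in> rects D" "R' \<in> rects D"
  shows "hcopy m a R \<noteq> vcopy m b R'"
  using inj_onD[OF inj_on_copy, of "(True, a, R)" "(False, b, R')"] assms by auto

lemma inj_on_copies:
  assumes "a \<in> X"
  shows "inj_on (hcopy m a) (rects D)" "inj_on (vcopy m a) (rects D)"
proof -
  have *: "R = R'" if "copy m (hor, a, R) = copy m (hor, a, R')" "R \<in> rects D" "R' \<in> rects D" for hor R R'
    using inj_onD[OF inj_on_copy that(1)] that assms by simp
  show "inj_on (hcopy m a) (rects D)" using *[of True] by (intro inj_onI) simp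
  show "inj_on (vcopy m a) (rects D)" using *[of False] by (intro inj_onI) simp
qed

lemma well_placed_crossbar: "well_placed (crossbar D)"
proof -
  have Xm: "set (xmarks (crossbar D)) \<subseteq> \<int> \<inter> {0<..<side (crossbar D)}"
  proof
    fix z assume "z \<in> set (xmarks (crossbar D))"
    then obtain a t where z: "z = m * a + t" "a \<in> X" "t \<in> Y"
      by (auto simp: crossbar_xmarks)
    note b = xmark_bounds[OF z(2)] ymark_bounds[OF z(3)]
    note s = side_bounds(2) side_bounds(3)[OF z(2)]
    have "z \<in> \<int>" "0 < z" "m * a < m * side D"
      using z b s by (simp_all add: add_pos_pos)
    then show "z \<in> \<int> \<inter> {0<..<side (crossbar D)}"
      using z b add_strict_mono[of "m * a" "m * side D" t "side D"] by (simp add: crossbar_side)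
  qed
  have off: "m * x \<noteq> z" "m * a + y \<noteq> z"
    if asm: "z \<in> set (xmarks (crossbar D))" "x \<in> \<int>" "a \<in> X" "0 \<le> y" "y < m" "y \<notin> Y" for z x a y
  proof -
    obtain b t where z: "z = m * b + t" "b \<in> X" "t \<in> Y"
      using asm by (auto simp: crossbar_xmarks)
    note b = xmark_bounds[OF z(2)] ymark_bounds[OF z(3)] xmark_bounds[OF asm(3)]
    have "m * x + 0 = m * b + t \<longleftrightarrow> x = b \<and> 0 = t" "m * a + y = m * b + t \<longleftrightarrow> a = b \<and> y = t"
      using b asm by (intro scaled_eq_iff; simp)+
    then show "m * x \<noteq> z" "m * a + y \<noteq> z" using z asm b by auto
  qed
  note int = side_bounds(1,2)
  have "side (crossbar D) \<in> \<int>" using int by (simp add: crossbar_side)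
  moreover have "{u1, u2, v1, v2} \<subseteq> \<int> \<and> 0 \<le> u1 \<and> u1 < u2 \<and> u2 \<le> side (crossbar D) \<and>
      0 \<le> v1 \<and> v1 < v2 \<and> v2 \<le> side (crossbar D) \<and>
      {u1, u2} \<inter> set (xmarks (crossbar D)) = {} \<and> {v1, v2} \<inter> set (xmarks (crossbar D)) = {}"
    if asm: "Rect u1 u2 v1 v2 \<in> rects (crossbar D)" for u1 u2 v1 v2
  proof -
    obtain hor a R where R: "Rect u1 u2 v1 v2 = copy m (hor, a, R)" "a \<in> X" "R \<in> rects D"
      using asm unfolding crossbar_rects by blast
    obtain x1 x2 y1 y2 where [simp]: "R = Rect x1 x2 y1 y2" by (cases R)
    note b = rect_bounds[OF R(3)[simplified]] xmark_bounds[OF R(2)]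
    have pos: "0 < m" using b by simp
    have sd: "0 \<le> side D" using b by linarith
    have le: "m * x2 \<le> m * side D" "m * a \<le> m * side D" "m * x1 < m * x2" "0 \<le> m * x1" "0 < m * a"
      using b pos sd by simp_all
    have iR: "m * x1 \<in> \<int>" "m * x2 \<in> \<int>" "m * a + y1 \<in> \<int>" "m * a + y2 \<in> \<int>"
      using b int by auto
    have y2: "0 \<le> y2" "y1 < m"
      using b by simp_all
    have n: "m * x1 \<notin> set (xmarks (crossbar D))" "m * x2 \<notin> set (xmarks (crossbar D))"
      "m * a + y1 \<notin> set (xmarks (crossbar D))" "m * a + y2 \<notin> set (xmarks (crossbar D))"
      using off[of _ x1 a y1] off[of _ x2 a y2] b y2 R by blast+
    have s: "side (crossbar D) = m * side D + side D" by (rule crossbar_side)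
    have cs: "(u1, u2, v1, v2) = (m * x1, m * x2, m * a + y1, m * a + y2) \<or>
        (v1, v2, u1, u2) = (m * x1, m * x2, m * a + y1, m * a + y2)"
      using R(1) by (cases hor) simp_all
    have ok: "{m * x1, m * x2, m * a + y1, m * a + y2} \<subseteq> \<int>" "m * x1 < m * x2" "m * a + y1 < m * a + y2"
      "0 \<le> m * x1" "0 \<le> m * a + y1" "m * x2 \<le> side (crossbar D)" "m * a + y2 \<le> side (crossbar D)"
      "{m * x1, m * x2} \<inter> set (xmarks (crossbar D)) = {}"
      "{m * a + y1, m * a + y2} \<inter> set (xmarks (crossbar D)) = {}"
      unfolding s using iR le(1-5) b(8,9,16) sd n by (simp_all add: add_mono add_increasing2)
    show ?thesis using cs
    proof
      assume "(u1, u2, v1, v2) = (m * x1, m * x2, m * a + y1, m * a + y2)"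
      then show ?thesis using ok by simp
    next
      assume "(v1, v2, u1, u2) = (m * x1, m * x2, m * a + y1, m * a + y2)"
      then show ?thesis using ok by simp
    qed
  qed
  ultimately show ?thesis
    using Xm unfolding well_placed_def crossbar_simps(3) by blast
qed

end

section \<open>Packings\<close>

text \<open>Packings are counted against the markers that they meet, in both directions because
  a crossbar uses the vertical markers of \<open>D\<close> to place its lines and the horizontal ones to subdivide
  its own markers.\<close>

definition xhits :: "drawing \<Rightarrow> rect set \<Rightarrow> real set" where
  "xhits D S = {a \<in> set (xmarks D). \<exists>R\<in>S. xmeets a R}"

definition yhits :: "drawing \<Rightarrow> rect set \<Rightarrow> real set" where
  "yhits D S = {a \<in> set (ymarks D). \<exists>R\<in>S. ymeets a R}"

definition marker_bounded :: "drawing \<Rightarrow> bool" where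
  "marker_bounded D \<longleftrightarrow> (\<forall>S \<subseteq> rects D. pairwise_disjoint S \<longrightarrow>
     card S \<le> card (xhits D S) \<and> card S \<le> card (yhits D S))"

lemma pairwise_disjoint_iff:
  "pairwise_disjoint S \<longleftrightarrow> (\<forall>R\<in>S. \<forall>R'\<in>S. R \<noteq> R' \<longrightarrow> \<not> meets R R')"
  by (auto simp: pairwise_disjoint_def meets_def)

lemma pairwise_disjoint_preimage:
  assumes S: "pairwise_disjoint S" and f: "inj_on f F"
    and meets: "\<And>R R'. R \<in> F \<Longrightarrow> R' \<in> F \<Longrightarrow> meets R R' \<Longrightarrow> meets (f R) (f R')"
  shows "pairwise_disjoint {R \<in> F. f R \<in> S}"
  unfolding pairwise_disjoint_iff
proof (intro ballI impI)
  fix R R' assume R: "R \<in> {R \<in> F. f R \<in> S}" "R' \<in> {R \<in> F. f R \<in> S}" "R \<noteq> R'"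
  then have "f R \<noteq> f R'" using f by (auto dest: inj_onD)
  then show "\<not> meets R R'" using R S meets by (auto simp: pairwise_disjoint_iff)
qed

lemma hits_finite [simp]: "finite (xhits D S)" "finite (yhits D S)"
  by (simp_all add: xhits_def yhits_def)

text \<open>\<open>A a\<close> and \<open>B b\<close> are the packings of \<open>D\<close> in row \<open>a\<close> and column \<open>b\<close>, and \<open>J\<close> consists of the columns
  that some row uses. Above a column in \<open>J\<close> all markers \<open>m * b + t\<close> are met, because a horizontal copy
  covers the whole width of the column; they pay for the cells \<open>(a, b)\<close>, each of which is used at
  most once. A column outside \<open>J\<close> holds only vertical copies, and these are met by the markers
  \<open>m * b + t\<close> such that the horizontal marker \<open>t\<close> meets \<open>B b\<close>. The hypothesis on cardinalities says that a
  column has at least as many new markers as cells.\<close>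

lemma (in placed_drawing) card_le_xhits_crossbar:
  assumes fin: "finite (rects D)" and bounded: "marker_bounded D" and XY: "card X \<le> card Y"
    and S: "S \<subseteq> rects (crossbar D)" "pairwise_disjoint S"
  shows "card S \<le> card (xhits (crossbar D) S)"
proof -
  define A where "A a = {R \<in> rects D. hcopy m a R \<in> S}" for a
  define B where "B a = {R \<in> rects D. vcopy m a R \<in> S}" for a
  define J where "J = (\<Union>a\<in>X. xhits D (A a))"
  have finAB [simp]: "finite (A a)" "finite (B a)" for a
    using fin by (simp_all add: A_def B_def)
  have sub: "A a \<subseteq> rects D" "B a \<subseteq> rects D" for a by (auto simp: A_def B_def)
  have disj: "pairwise_disjoint (A a)" "pairwise_disjoint (B a)" if a: "a \<in> X" for a
    unfolding A_def B_def
    by (rule pairwise_disjoint_preimage[OF S(2)];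
        simp add: inj_on_copies a meets_hcopy_hcopy meets_vcopy_vcopy)+
  have J: "J \<subseteq> X" by (auto simp: J_def xhits_def)
  have finJ: "finite J" using J by (rule finite_subset) simp
  have "S \<subseteq> (\<Union>a\<in>X. hcopy m a ` A a) \<union> (\<Union>a\<in>X. vcopy m a ` B a)"
    using S(1) unfolding crossbar_rects A_def B_def by (fastforce split: if_splits)
  then have "card S \<le> card ((\<Union>a\<in>X. hcopy m a ` A a) \<union> (\<Union>a\<in>X. vcopy m a ` B a))"
    by (intro card_mono) auto
  also have "\<dots> \<le> card (\<Union>a\<in>X. hcopy m a ` A a) + card (\<Union>a\<in>X. vcopy m a ` B a)"
    by (rule card_Un_le)
  also have "\<dots> \<le> (\<Sum>a\<in>X. card (hcopy m a ` A a)) + (\<Sum>a\<in>X. card (vcopy m a ` B a))"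
    by (intro add_mono card_UN_le) auto
  also have "\<dots> \<le> (\<Sum>a\<in>X. card (A a)) + (\<Sum>a\<in>X. card (B a))"
    by (intro add_mono sum_mono card_image_le) auto
  also have "\<dots> = (\<Sum>a\<in>X. card (A a)) + (\<Sum>b\<in>J. card (B b)) + (\<Sum>b\<in>X - J. card (B b))"
    using sum.subset_diff[OF J, of "\<lambda>b. card (B b)"] by simp
  also have "\<dots> \<le> (\<Sum>a\<in>X. card (xhits D (A a))) + (\<Sum>b\<in>J. card (xhits D (B b)))
      + (\<Sum>b\<in>X - J. card (yhits D (B b)))"
    using bounded sub disj J unfolding marker_bounded_def
    by (intro add_mono sum_mono) auto
  also have "(\<Sum>a\<in>X. card (xhits D (A a))) + (\<Sum>b\<in>J. card (xhits D (B b)))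
      = card (SIGMA a:X. xhits D (A a)) + card (prod.swap ` (SIGMA b:J. xhits D (B b)))"
    using finJ by (simp add: card_image)
  also have "\<dots> = card ((SIGMA a:X. xhits D (A a)) \<union> prod.swap ` (SIGMA b:J. xhits D (B b)))"
  proof (rule card_Un_disjoint[symmetric])
    \<comment> \<open>A common cell \<open>(a, b)\<close> would make a rectangle of row \<open>a\<close> meet one of column \<open>b\<close>.\<close>
    have False if cell: "a \<in> X" "b \<in> xhits D (A a)" "a \<in> xhits D (B b)" for a b
    proof -
      obtain R R' where R: "R \<in> A a" "xmeets b R" "R' \<in> B b" "xmeets a R'" "b \<in> X"
        using cell by (auto simp: xhits_def)
      then have "meets (hcopy m a R) (vcopy m b R')" "R \<in> rects D" "R' \<in> rects D"
        using cell by (auto simp: meets_hcopy_vcopy A_def B_def)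
      moreover have "hcopy m a R \<noteq> vcopy m b R'"
        using R cell by (intro hcopy_neq_vcopy) (auto simp: A_def B_def)
      ultimately show False
        using R S(2) by (auto simp: pairwise_disjoint_iff A_def B_def)
    qed
    then show "(SIGMA a:X. xhits D (A a)) \<inter> prod.swap ` (SIGMA b:J. xhits D (B b)) = {}"
      by auto
  qed (use finJ in auto)
  also have "\<dots> \<le> card (X \<times> J)"
  proof (rule card_mono)
    show "(SIGMA a:X. xhits D (A a)) \<union> prod.swap ` (SIGMA b:J. xhits D (B b)) \<subseteq> X \<times> J"
      by (auto simp: J_def xhits_def) blast+
  qed (use finJ in auto)
  also have "\<dots> \<le> card (J \<times> Y)"
    using XY by (simp add: card_cartesian_product)
  also have "card (J \<times> Y) + (\<Sum>b\<in>X - J. card (yhits D (B b)))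
      = card (J \<times> Y) + card (SIGMA b:X - J. yhits D (B b))"
    by simp
  also have "\<dots> = card (J \<times> Y \<union> (SIGMA b:X - J. yhits D (B b)))"
    by (rule card_Un_disjoint[symmetric]) (use finJ in auto)
  also have "\<dots> = card ((\<lambda>(a, t). m * a + t) ` (J \<times> Y \<union> (SIGMA b:X - J. yhits D (B b))))"
    by (rule card_image[symmetric], rule inj_on_subset[OF inj_on_marks])
      (use J in \<open>auto simp: yhits_def\<close>)
  also have "\<dots> \<le> card (xhits (crossbar D) S)"
  proof (intro card_mono hits_finite subsetI)
    fix z assume "z \<in> (\<lambda>(a, t). m * a + t) ` (J \<times> Y \<union> (SIGMA b:X - J. yhits D (B b)))"
    then obtain b t where z: "z = m * b + t" and bt: "b \<in> J \<and> t \<in> Y \<or> b \<in> X \<and> t \<in> yhits D (B b)"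
      by auto
    then have b: "b \<in> X" "t \<in> Y" using J by (auto simp: yhits_def)
    have "\<exists>R\<in>S. xmeets z R"
    proof (cases "b \<in> J")
      case True
      then obtain a R where "a \<in> X" "R \<in> A a" "xmeets b R" by (auto simp: J_def xhits_def)
      then show ?thesis using b by (intro bexI[of _ "hcopy m a R"]) (auto simp: z A_def xmeets_hcopy)
    next
      case False
      then obtain R where "R \<in> B b" "ymeets t R" using bt by (auto simp: yhits_def)
      then show ?thesis using b by (intro bexI[of _ "vcopy m b R"]) (auto simp: z B_def xmeets_vcopy)
    qed
    then show "z \<in> xhits (crossbar D) S"
      using z b by (auto simp: xhits_def crossbar_xmarks)
  qed
  finally show ?thesis by simp
qed

lemma (in placed_drawing) marker_bounded_crossbar:
  assumes "finite (rects D)" "marker_bounded D" "card X \<le> card Y"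
  shows "marker_bounded (crossbar D)"
  unfolding marker_bounded_def
proof (intro allI impI conjI)
  fix S assume S: "S \<subseteq> rects (crossbar D)" "pairwise_disjoint S"
  show "card S \<le> card (xhits (crossbar D) S)"
    by (rule card_le_xhits_crossbar[OF assms S])
  have "inj flip" by (metis flip_simps(1) injI)
  have "flip ` S \<subseteq> rects (crossbar D)" using S(1) flip_crossbar by auto
  moreover have "pairwise_disjoint (flip ` S)" using S(2) by (auto simp: pairwise_disjoint_iff)
  ultimately have "card (flip ` S) \<le> card (xhits (crossbar D) (flip ` S))"
    by (rule card_le_xhits_crossbar[OF assms])
  also have "xhits (crossbar D) (flip ` S) = yhits (crossbar D) S"
    by (simp add: xhits_def yhits_def crossbar_simps(3))
  finally show "card S \<le> card (yhits (crossbar D) S)"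
    using \<open>inj flip\<close> by (simp add: card_image inj_on_subset)
qed

lemma base_marks:
  "set (xmarks base_drawing) = {3, 11, 19, 27}" "set (ymarks base_drawing) = {3, 11, 21, 27}"
  "side base_drawing = 30"
  by (simp_all add: base_drawing_def)

lemma well_placed_base: "well_placed base_drawing"
  by (auto simp: well_placed_def base_drawing_def)

text \<open>Membership in \<open>S\<close> is recorded by one truth value for each of the eight rectangles; the six
  intersecting pairs are the overlap of \<open>l\<close> and \<open>r\<close> and the five-cycle \<open>c0, c1, c2, c3, q\<close>.\<close>

lemma marker_bounded_base: "marker_bounded base_drawing"
  unfolding marker_bounded_def
proof (intro allI impI)
  fix S assume S: "S \<subseteq> rects base_drawing" "pairwise_disjoint S"
  let ?P = "rects base_drawing"
  have fin: "finite ?P" by (simp add: base_drawing_def)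
  have card: "card S = (\<Sum>R\<in>?P. of_bool (R \<in> S))"
    using S(1) fin by (simp add: sum_of_bool_eq Int_absorb1)
  have ex: "(\<exists>R\<in>S. f R) \<longleftrightarrow> (\<exists>R\<in>?P. R \<in> S \<and> f R)" for f
    using S(1) by auto
  have xcard: "card (xhits base_drawing S) =
      (\<Sum>a\<in>set (xmarks base_drawing). of_bool (\<exists>R\<in>?P. R \<in> S \<and> xmeets a R))"
    by (simp add: sum_of_bool_eq xhits_def ex Int_def)
  have ycard: "card (yhits base_drawing S) =
      (\<Sum>a\<in>set (ymarks base_drawing). of_bool (\<exists>R\<in>?P. R \<in> S \<and> ymeets a R))"
    by (simp add: sum_of_bool_eq yhits_def ex Int_def)
  define t where "t \<longleftrightarrow> Rect 0 30 26 28 \<in> S"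
  define l where "l \<longleftrightarrow> Rect 0 16 20 22 \<in> S"
  define r where "r \<longleftrightarrow> Rect 14 30 20 22 \<in> S"
  define c0 where "c0 \<longleftrightarrow> Rect 0 8 2 10 \<in> S"
  define c1 where "c1 \<longleftrightarrow> Rect 6 16 8 14 \<in> S"
  define c2 where "c2 \<longleftrightarrow> Rect 14 24 8 14 \<in> S"
  define c3 where "c3 \<longleftrightarrow> Rect 22 30 2 12 \<in> S"
  define q where "q \<longleftrightarrow> Rect 6 24 0 4 \<in> S"
  note defs = t_def l_def r_def c0_def c1_def c2_def c3_def q_def
  have disj: "\<not> meets R R'" if "R \<in> S" "R' \<in> S" "R \<noteq> R'" for R R'
    using S(2) that by (auto simp: pairwise_disjoint_iff)
  have pairs: "\<not> (l \<and> r)" "\<not> (c0 \<and> c1)" "\<not> (c1 \<and> c2)" "\<not> (c2 \<and> c3)" "\<not> (c3 \<and> q)" "\<not> (q \<and> c0)"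
    unfolding defs by (rule notI, elim conjE, drule (1) disj, simp, simp add: meets_Rect)+
  have card_S: "card S = of_bool t + (of_bool l + (of_bool r + (of_bool c0 +
      (of_bool c1 + (of_bool c2 + (of_bool c3 + of_bool q))))))"
    unfolding card defs by (simp add: base_drawing_def)
  have hit: "(\<exists>R\<in>?P. R \<in> S \<and> xmeets 3 R) \<longleftrightarrow> t \<or> l \<or> c0"
    "(\<exists>R\<in>?P. R \<in> S \<and> xmeets 11 R) \<longleftrightarrow> t \<or> l \<or> c1 \<or> q"
    "(\<exists>R\<in>?P. R \<in> S \<and> xmeets 19 R) \<longleftrightarrow> t \<or> r \<or> c2 \<or> q"
    "(\<exists>R\<in>?P. R \<in> S \<and> xmeets 27 R) \<longleftrightarrow> t \<or> r \<or> c3"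
    "(\<exists>R\<in>?P. R \<in> S \<and> ymeets 3 R) \<longleftrightarrow> c0 \<or> c3 \<or> q"
    "(\<exists>R\<in>?P. R \<in> S \<and> ymeets 11 R) \<longleftrightarrow> c1 \<or> c2 \<or> c3"
    "(\<exists>R\<in>?P. R \<in> S \<and> ymeets 21 R) \<longleftrightarrow> l \<or> r"
    "(\<exists>R\<in>?P. R \<in> S \<and> ymeets 27 R) \<longleftrightarrow> t"
    unfolding defs by (simp_all add: base_drawing_def)
  have card_x: "card (xhits base_drawing S) = of_bool (t \<or> l \<or> c0) + (of_bool (t \<or> l \<or> c1 \<or> q) +
      (of_bool (t \<or> r \<or> c2 \<or> q) + of_bool (t \<or> r \<or> c3)))"
    unfolding xcard base_marks by (simp add: hit)
  have card_y: "card (yhits base_drawing S) = of_bool (c0 \<or> c3 \<or> q) + (of_bool (c1 \<or> c2 \<or> c3) +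
      (of_bool (l \<or> r) + of_bool t))"
    unfolding ycard base_marks by (simp add: hit)
  show "card S \<le> card (xhits base_drawing S) \<and> card S \<le> card (yhits base_drawing S)"
    unfolding card_S card_x card_y
    using pairs by (cases t; cases l; cases r; cases c0; cases c1; cases c2; cases c3; cases q; simp)
qed

lemma packing_number_le_markers:
  assumes "marker_bounded D"
  shows "packing_number (rects D) \<le> length (xmarks D)"
proof -
  let ?P = "{card S |S. S \<subseteq> rects D \<and> pairwise_disjoint S}"
  have le: "card S \<le> length (xmarks D)" if "S \<subseteq> rects D" "pairwise_disjoint S" for S
  proof -
    have "card S \<le> card (xhits D S)"
      using assms that unfolding marker_bounded_def by blast
    also have "\<dots> \<le> card (set (xmarks D))"
      by (intro card_mono) (auto simp: xhits_def)
    also have "\<dots> \<le> length (xmarks D)" by (rule card_length)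
    finally show ?thesis .
  qed
  then have "?P \<subseteq> {..length (xmarks D)}" by auto
  then have "finite ?P" by (rule finite_subset) simp
  moreover have "0 \<in> ?P" by (auto simp: pairwise_disjoint_def intro!: exI[of _ "{}"])
  ultimately show ?thesis
    unfolding packing_number_def using le by (subst Max_le_iff) auto
qed

lemma packing_number_ge_1:
  assumes "finite F" "F \<noteq> {}"
  shows "1 \<le> packing_number F"
proof -
  let ?P = "{card S |S. S \<subseteq> F \<and> pairwise_disjoint S}"
  obtain R where "R \<in> F" using assms(2) by blast
  then have "1 \<in> ?P" by (auto simp: pairwise_disjoint_def intro!: exI[of _ "{R}"])
  moreover have "?P \<subseteq> card ` Pow F" by auto
  then have "finite ?P" using assms(1) by (meson finite_Pow_iff finite_imageI finite_subset)
  ultimately show ?thesis unfolding packing_number_def by (intro Max_ge)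
qed

lemma packing_number_rect_family_2:
  "packing_number (rect_family 2) \<le> 256" "1 \<le> packing_number (rect_family 2)"
proof -
  let ?D = base_drawing
  interpret base: placed_drawing ?D "side ?D + 1"
    by unfold_locales (rule well_placed_base)
  interpret one: placed_drawing "crossbar ?D" "side (crossbar ?D) + 1"
    by unfold_locales (rule base.well_placed_crossbar)
  have fin: "finite (rects ?D)" "finite (rects (crossbar ?D))"
    using finite_rect_family[of 0] finite_rect_family[of 1] by (simp_all add: rect_family_def)
  have two: "rect_family 2 = rects (crossbar (crossbar ?D))"
    by (simp add: rect_family_def numeral_2_eq_2)
  have "marker_bounded (crossbar ?D)"
    by (rule base.marker_bounded_crossbar[OF fin(1) marker_bounded_base]) (simp add: base_marks)
  then have "marker_bounded (crossbar (crossbar ?D))"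
    by (rule one.marker_bounded_crossbar[OF fin(2)]) (simp add: crossbar_simps(3))
  then have "packing_number (rect_family 2) \<le> length (xmarks (crossbar (crossbar ?D)))"
    unfolding two by (rule packing_number_le_markers)
  also have "\<dots> = 256"
    by (simp add: crossbar_def Let_def base_drawing_def)
  finally show "packing_number (rect_family 2) \<le> 256" .
  have "rects ?D \<noteq> {}" by (simp add: base_drawing_def)
  then have "rect_family 2 \<noteq> {}"
    unfolding two one.crossbar_rects base.crossbar_rects base.crossbar_xmarks by (auto simp: base_marks)
  then show "1 \<le> packing_number (rect_family 2)"
    by (intro packing_number_ge_1 finite_rect_family)
qed

section \<open>Cliques and weights in a crossbar\<close>

lemma is_clique_iff:
  "is_clique (intersection_graph F) K \<longleftrightarrow>
     K \<subseteq> F \<and> (\<forall>R\<in>K. \<forall>R'\<in>K. R \<noteq> R' \<longrightarrow> meets R R')"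
proof -
  have fst: "fst (intersection_graph F) = F" by (simp add: intersection_graph_def)
  have "{R, R'} \<in> snd (intersection_graph F) \<longleftrightarrow> meets R R'"
    if "R \<in> F" "R' \<in> F" "R \<noteq> R'" for R R'
    using that unfolding intersection_graph_def meets_def
    by (auto simp: doubleton_eq_iff Int_commute)
  then show ?thesis
    by (auto simp: is_clique_def fst subset_iff)
qed

context placed_drawing begin

definition lift :: "(bool \<Rightarrow> real \<Rightarrow> rect \<Rightarrow> real) \<Rightarrow> rect \<Rightarrow> real" where
  "lift W R = (case the_inv_into (UNIV \<times> X \<times> rects D) (copy m) R of (hor, a, S) \<Rightarrow> W hor a S)"

lemma lift_copy:
  assumes "a \<in> X" "R \<in> rects D"
  shows "lift W (hcopy m a R) = W True a R" "lift W (vcopy m a R) = W False a R"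
  using the_inv_into_f_f[OF inj_on_copy, of "(True, a, R)"]
    the_inv_into_f_f[OF inj_on_copy, of "(False, a, R)"] assms
  by (simp_all add: lift_def)

lemma sum_lift_copies:
  assumes "finite (rects D)" "a \<in> X" "b \<in> X" "A \<subseteq> rects D" "B \<subseteq> rects D"
  shows "(\<Sum>R\<in>hcopy m a ` A \<union> vcopy m b ` B. lift W R) = (\<Sum>R\<in>A. W True a R) + (\<Sum>R\<in>B. W False b R)"
proof -
  have fin: "finite A" "finite B" using assms finite_subset by blast+
  have "hcopy m a ` A \<inter> vcopy m b ` B = {}"
    using hcopy_neq_vcopy assms by blast
  then have "(\<Sum>R\<in>hcopy m a ` A \<union> vcopy m b ` B. lift W R) =
      (\<Sum>R\<in>hcopy m a ` A. lift W R) + (\<Sum>R\<in>vcopy m b ` B. lift W R)"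
    using fin by (intro sum.union_disjoint) auto
  also have "(\<Sum>R\<in>hcopy m a ` A. lift W R) = (\<Sum>R\<in>A. W True a R)"
    using assms inj_on_subset[OF inj_on_copies(1)]
    by (subst sum.reindex) (auto intro!: sum.cong lift_copy)
  also have "(\<Sum>R\<in>vcopy m b ` B. lift W R) = (\<Sum>R\<in>B. W False b R)"
    using assms inj_on_subset[OF inj_on_copies(2)]
    by (subst sum.reindex) (auto intro!: sum.cong lift_copy)
  finally show ?thesis .
qed

lemma sum_lift:
  "(\<Sum>R\<in>rects (crossbar D). lift W R) =
     (\<Sum>a\<in>X. \<Sum>R\<in>rects D. W True a R) + (\<Sum>a\<in>X. \<Sum>R\<in>rects D. W False a R)"
proof -
  have "(\<Sum>R\<in>rects (crossbar D). lift W R) = (\<Sum>p\<in>UNIV \<times> X \<times> rects D. lift W (copy m p))"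
    unfolding crossbar_rects by (subst sum.reindex[OF inj_on_copy]) simp
  also have "\<dots> = (\<Sum>p\<in>UNIV \<times> X \<times> rects D. case p of (hor, a, R) \<Rightarrow> W hor a R)"
    by (intro sum.cong) (auto simp: lift_copy)
  also have "\<dots> = (\<Sum>hor\<in>UNIV. \<Sum>a\<in>X. \<Sum>R\<in>rects D. W hor a R)"
    by (simp add: sum.cartesian_product')
  finally show ?thesis by (simp add: UNIV_bool add.commute)
qed

lemma lift_nonneg:
  assumes "\<And>hor a R. a \<in> X \<Longrightarrow> R \<in> rects D \<Longrightarrow> 0 \<le> W hor a R" "R \<in> rects (crossbar D)"
  shows "0 \<le> lift W R"
proof -
  obtain hor a S where "R = copy m (hor, a, S)" "a \<in> X" "S \<in> rects D"
    using assms(2) unfolding crossbar_rects by blast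
  then show ?thesis using assms(1) by (simp add: lift_copy)
qed

lemma meets_refl: "R \<in> rects D \<Longrightarrow> meets R R"
  using rect_bounds by (cases R) (simp add: meets_Rect less_imp_le)

text \<open>Copies in different rows are disjoint, so all horizontal members of a clique share a row, and all
  vertical ones a column. An empty part leaves its line undetermined, and then any marker serves.\<close>

lemma crossbar_clique_cases:
  assumes K: "is_clique (intersection_graph (rects (crossbar D))) K" and ne: "X \<noteq> {}"
  obtains a b A B where "a \<in> X" "b \<in> X" "K = hcopy m a ` A \<union> vcopy m b ` B"
    "is_clique (intersection_graph (rects D)) A" "is_clique (intersection_graph (rects D)) B"
    "A \<noteq> {} \<Longrightarrow> B \<noteq> {} \<Longrightarrow> (\<forall>R\<in>A. xmeets b R) \<and> (\<forall>R\<in>B. xmeets a R)"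
proof -
  have copies: "\<exists>hor a R. S = copy m (hor, a, R) \<and> a \<in> X \<and> R \<in> rects D" if "S \<in> K" for S
    using K that unfolding is_clique_iff crossbar_rects by blast
  have meets: "meets S S'" if S: "S \<in> K" "S' \<in> K" for S S'
  proof (cases "S = S'")
    case True
    obtain hor a R where "S = copy m (hor, a, R)" "a \<in> X" "R \<in> rects D"
      using copies[OF S(1)] by blast
    then show ?thesis
      using True by (simp add: meets_hcopy_hcopy meets_vcopy_vcopy meets_refl)
  qed (use K S in \<open>simp add: is_clique_iff\<close>)
  obtain x where x: "x \<in> X" using ne by (meson ex_in_conv)
  have "\<exists>a\<in>X. \<forall>a'\<in>X. \<forall>R\<in>rects D. hcopy m a' R \<in> K \<longrightarrow> a' = a"
  proof (cases "\<exists>a\<in>X. \<exists>R\<in>rects D. hcopy m a R \<in> K")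
    case True
    then obtain a R where "a \<in> X" "R \<in> rects D" "hcopy m a R \<in> K" by blast
    then show ?thesis using meets meets_hcopy_hcopy by (intro bexI[of _ a]) blast+
  qed (use x in blast)
  then obtain a where a: "a \<in> X" "\<And>a' R. a' \<in> X \<Longrightarrow> R \<in> rects D \<Longrightarrow> hcopy m a' R \<in> K \<Longrightarrow> a' = a"
    by blast
  have "\<exists>b\<in>X. \<forall>b'\<in>X. \<forall>R\<in>rects D. vcopy m b' R \<in> K \<longrightarrow> b' = b"
  proof (cases "\<exists>b\<in>X. \<exists>R\<in>rects D. vcopy m b R \<in> K")
    case True
    then obtain b R where "b \<in> X" "R \<in> rects D" "vcopy m b R \<in> K" by blast
    then show ?thesis using meets meets_vcopy_vcopy by (intro bexI[of _ b]) blast+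
  qed (use x in blast)
  then obtain b where b: "b \<in> X" "\<And>b' R. b' \<in> X \<Longrightarrow> R \<in> rects D \<Longrightarrow> vcopy m b' R \<in> K \<Longrightarrow> b' = b"
    by blast
  define A where "A = {R \<in> rects D. hcopy m a R \<in> K}"
  define B where "B = {R \<in> rects D. vcopy m b R \<in> K}"
  show thesis
  proof (rule that)
    show "a \<in> X" "b \<in> X" by fact+
    show "K = hcopy m a ` A \<union> vcopy m b ` B"
    proof (intro set_eqI iffI)
      fix S assume S: "S \<in> K"
      obtain hor c R where c: "S = copy m (hor, c, R)" "c \<in> X" "R \<in> rects D"
        using copies[OF S] by blast
      then show "S \<in> hcopy m a ` A \<union> vcopy m b ` B"
        using S a(2)[OF c(2,3)] b(2)[OF c(2,3)] by (cases hor) (auto simp: A_def B_def)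
    qed (auto simp: A_def B_def)
    show "is_clique (intersection_graph (rects D)) A"
      using meets a(1) unfolding is_clique_iff A_def
      by (metis (no_types, lifting) meets_hcopy_hcopy mem_Collect_eq subsetI)
    show "is_clique (intersection_graph (rects D)) B"
      using meets b(1) unfolding is_clique_iff B_def
      by (metis (no_types, lifting) meets_vcopy_vcopy mem_Collect_eq subsetI)
    have "xmeets b R \<and> xmeets a R'" if "R \<in> A" "R' \<in> B" for R R'
      using meets[of "hcopy m a R" "vcopy m b R'"] that a(1) b(1)
      by (simp add: A_def B_def meets_hcopy_vcopy)
    then show "(\<forall>R\<in>A. xmeets b R) \<and> (\<forall>R\<in>B. xmeets a R)" if "A \<noteq> {}" "B \<noteq> {}"
      using that by blast
  qed
qed

text \<open>A cell \<open>(a, b)\<close> is split between row \<open>a\<close>, which may load it up to \<open>cap a b\<close>, and column \<open>b\<close>, which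
  may load it up to \<open>cap b a\<close>. The same weight \<open>w a\<close> serves for row \<open>a\<close> and column \<open>a\<close>, whence the
  factor \<open>2\<close>.\<close>

lemma alpha_star_crossbar_ge:
  assumes fin: "finite (rects D)" and ne: "X \<noteq> {}"
    and nonneg: "\<And>a R. a \<in> X \<Longrightarrow> R \<in> rects D \<Longrightarrow> 0 \<le> w a R"
    and le_1: "\<And>a K. a \<in> X \<Longrightarrow> is_clique (intersection_graph (rects D)) K \<Longrightarrow> sum (w a) K \<le> 1"
    and le_cap: "\<And>a b K. a \<in> X \<Longrightarrow> b \<in> X \<Longrightarrow> is_clique (intersection_graph (rects D)) K \<Longrightarrow>
      \<forall>R\<in>K. xmeets b R \<Longrightarrow> sum (w a) K \<le> cap a b"
    and cap: "\<And>a b. a \<in> X \<Longrightarrow> b \<in> X \<Longrightarrow> cap a b + cap b a \<le> 1"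
  shows "2 * (\<Sum>a\<in>X. sum (w a) (rects D)) \<le> alpha_star (intersection_graph (rects (crossbar D)))"
proof -
  let ?G = "intersection_graph (rects (crossbar D))" and ?x = "lift (\<lambda>hor. w)"
  have fst: "fst ?G = rects (crossbar D)" by (simp add: intersection_graph_def)
  have "finite (fst ?G)" unfolding fst unfolding crossbar_rects using fin by simp
  moreover have "clique_feasible ?G ?x"
    unfolding clique_feasible_def fst
  proof (intro conjI ballI allI impI)
    show "0 \<le> ?x R" if "R \<in> rects (crossbar D)" for R
      using that nonneg by (intro lift_nonneg)
    fix K assume "is_clique ?G K"
    then obtain a b A B where ab: "a \<in> X" "b \<in> X" and K: "K = hcopy m a ` A \<union> vcopy m b ` B"
      and A: "is_clique (intersection_graph (rects D)) A"
      and B: "is_clique (intersection_graph (rects D)) B"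
      and cross: "A \<noteq> {} \<Longrightarrow> B \<noteq> {} \<Longrightarrow> (\<forall>R\<in>A. xmeets b R) \<and> (\<forall>R\<in>B. xmeets a R)"
      using crossbar_clique_cases[OF _ ne] by metis
    have "sum ?x K = sum (w a) A + sum (w b) B"
      unfolding K using A B ab fin by (intro sum_lift_copies) (simp_all add: is_clique_iff)
    also have "\<dots> \<le> 1"
    proof (cases "A = {} \<or> B = {}")
      case True
      then show ?thesis using le_1[OF ab(1) A] le_1[OF ab(2) B] by auto
    next
      case False
      then show ?thesis
        using le_cap[OF ab A] le_cap[OF ab(2,1) B] cross cap[OF ab] by force
    qed
    finally show "sum ?x K \<le> 1" .
  qed
  ultimately have "sum ?x (fst ?G) \<le> alpha_star ?G" by (rule alpha_star_is_max(2))
  then show ?thesis unfolding fst by (simp add: sum_lift)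
qed

text \<open>The input needed for a second crossbar step. All horizontal copies weigh \<open>p\<close> and vertical copies
  at most \<open>p\<close>. A clique contains at most two copies: two in one line because \<open>D\<close> is triangle free, or
  one of each kind, since a part that crosses another line is a clique on a common marker of \<open>D\<close> and
  hence a single rectangle. On a marker
  \<open>m * b + t\<close> two horizontal copies are impossible for the same reason, so at least one of the two is
  a vertical copy that meets the height \<open>t\<close> and thus weighs at most \<open>c\<close>.\<close>

lemma clique_weight_crossbar_le:
  assumes fin: "finite (rects D)" and ne: "X \<noteq> {}"
    and triangle_free: "\<And>K. is_clique (intersection_graph (rects D)) K \<Longrightarrow> card K \<le> 2"
    and marker_simple: "\<And>K b. is_clique (intersection_graph (rects D)) K \<Longrightarrow> b \<in> X \<Longrightarrow>
      \<forall>R\<in>K. xmeets b R \<Longrightarrow> card K \<le> 1"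
    and g: "\<And>R. R \<in> rects D \<Longrightarrow> 0 \<le> g R \<and> g R \<le> p" and p: "0 \<le> p"
    and K: "is_clique (intersection_graph (rects (crossbar D))) K"
  shows "sum (lift (\<lambda>hor a R. if hor then p else g R)) K \<le> 2 * p"
    and "b \<in> X \<Longrightarrow> t \<in> Y \<Longrightarrow> \<forall>R\<in>K. xmeets (m * b + t) R \<Longrightarrow> 0 \<le> c \<Longrightarrow> c \<le> p \<Longrightarrow>
      (\<And>R. R \<in> rects D \<Longrightarrow> ymeets t R \<Longrightarrow> g R \<le> c) \<Longrightarrow>
      sum (lift (\<lambda>hor a R. if hor then p else g R)) K \<le> p + c"
proof -
  let ?x = "lift (\<lambda>hor a R. if hor then p else g R)"
  obtain a d A B where ad: "a \<in> X" "d \<in> X" and K: "K = hcopy m a ` A \<union> vcopy m d ` B"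
    and A: "is_clique (intersection_graph (rects D)) A"
    and B: "is_clique (intersection_graph (rects D)) B"
    and cross: "A \<noteq> {} \<Longrightarrow> B \<noteq> {} \<Longrightarrow> (\<forall>R\<in>A. xmeets d R) \<and> (\<forall>R\<in>B. xmeets a R)"
    using crossbar_clique_cases[OF K ne] by metis
  have sub: "A \<subseteq> rects D" "B \<subseteq> rects D" using A B by (simp_all add: is_clique_iff)
  have sum: "sum ?x K = card A * p + sum g B"
    unfolding K using sum_lift_copies[OF fin ad sub] by simp
  have bound: "sum ?x K \<le> p + q"
    if q: "0 \<le> q" "q \<le> p" and gq: "\<And>R. R \<in> B \<Longrightarrow> g R \<le> q" and Aq: "B = {} \<Longrightarrow> card A * p \<le> p + q" for q
  proof (cases "B = {}")
    case False
    have sumB: "sum g B \<le> card B * q" using gq by (rule sum_bounded_above)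
    show ?thesis
    proof (cases "A = {}")
      case True
      have "card B * q \<le> 2 * q" using triangle_free[OF B] q by (intro mult_right_mono) simp_all
      then show ?thesis using True sumB q unfolding sum by simp
    next
      case nonempty: False
      have "card A \<le> 1" "card B \<le> 1"
        using marker_simple[OF A ad(2)] marker_simple[OF B ad(1)] cross False nonempty by auto
      then have "card A * p \<le> 1 * p" "card B * q \<le> 1 * q"
        using p q by (intro mult_right_mono; simp)+
      then show ?thesis using sumB unfolding sum by simp
    qed
  qed (use Aq sum in simp)
  have "card A * p \<le> 2 * p" using triangle_free[OF A] p by (intro mult_right_mono) simp_all
  then show "sum ?x K \<le> 2 * p"
    using bound[of p] g p sub by auto
  assume b: "b \<in> X" and t: "t \<in> Y" and marked: "\<forall>R\<in>K. xmeets (m * b + t) R"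
    and c: "0 \<le> c" "c \<le> p" and gc: "\<And>R. R \<in> rects D \<Longrightarrow> ymeets t R \<Longrightarrow> g R \<le> c"
  have "ymeets t R" if "R \<in> B" for R
    using that marked K sub xmeets_vcopy[OF _ ad(2) b t] by auto
  moreover have "\<forall>R\<in>A. xmeets b R"
    using marked K sub xmeets_hcopy[OF _ b t] by (metis UnI1 imageI subsetD)
  then have "card A * p \<le> 1 * p"
    using marker_simple[OF A b] p by (intro mult_right_mono) simp_all
  ultimately show "sum ?x K \<le> p + c"
    using c gc sub by (intro bound) auto
qed

end

section \<open>Weights for the second family\<close>

text \<open>The weights \<open>w\<close> on the first crossbar, when it is placed in a line with marker \<open>31 \<xi> + t\<close>:
  \<open>bar_weight t\<close> is for its horizontal copies, and \<open>post_weight t y\<close> for the vertical copies of base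
  rectangles at height \<open>y\<close>. The thresholds \<open>15\<close> and \<open>25\<close> separate the three levels of the base family,
  namely the five-cycle, the pair at height \<open>21\<close> and the long rectangle at height \<open>27\<close>; the same
  thresholds apply to markers. Cliques on a marker of height \<open>y\<close> weigh at most
  \<open>cap t y = bar_weight t + post_weight t y\<close>, and \<open>post_weight\<close> is chosen so that
  \<open>cap t y + cap y t = 1\<close> for all marker heights.\<close>

definition bar_weight :: "real \<Rightarrow> real" where
  "bar_weight t = (if t < 15 then 1/4 else 3/8)"

definition post_weight :: "real \<Rightarrow> real \<Rightarrow> real" where
  "post_weight t y =
     (if y < 15 then bar_weight t
      else if y < 25 then (if t < 15 then 0 else if t < 25 then 1/8 else 1/4)
      else (if t < 25 then 0 else 1/8))"

fun top_edge :: "rect \<Rightarrow> real" where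
  "top_edge (Rect x1 x2 y1 y2) = y2"

text \<open>The residue modulo \<open>31 = L + 1\<close>, with \<open>L = 30\<close> the side of the base drawing. It recovers the height
  \<open>t\<close> from a marker \<open>31 \<xi> + t\<close>.\<close>

definition offset :: "real \<Rightarrow> real" where
  "offset z = z - 31 * of_int \<lfloor>z / 31\<rfloor>"

lemma offset_marker:
  assumes "a \<in> \<int>" "0 \<le> t" "t < 31"
  shows "offset (31 * a + t) = t"
proof -
  obtain k where "a = of_int k" using assms(1) by (elim Ints_cases)
  then have "(31 * a + t) / 31 = of_int k + t / 31" by simp
  moreover have "\<lfloor>of_int k + t / 31\<rfloor> = k" using assms by (simp add: floor_eq_iff)
  ultimately have "\<lfloor>(31 * a + t) / 31\<rfloor> = k" by (simp only:)
  then show ?thesis using \<open>a = of_int k\<close> by (simp add: offset_def)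
qed

lemma base_triangle_free:
  assumes "is_clique (intersection_graph (rects base_drawing)) K"
  shows "card K \<le> 2"
proof (rule ccontr)
  assume "\<not> card K \<le> 2"
  then obtain T where "T \<subseteq> K" "card T = 3"
    using obtain_subset_with_card_n[of 3 K] by auto
  then obtain R S T where "R \<in> K" "S \<in> K" "T \<in> K" "R \<noteq> S" "S \<noteq> T" "R \<noteq> T"
    by (auto simp: card_3_iff)
  then have "R \<in> rects base_drawing" "S \<in> rects base_drawing" "T \<in> rects base_drawing"
    "R \<noteq> S" "S \<noteq> T" "R \<noteq> T" "meets R S" "meets S T" "meets R T"
    using assms by (auto simp: is_clique_iff)
  moreover have "\<forall>R\<in>rects base_drawing. \<forall>S\<in>rects base_drawing. R \<noteq> S \<longrightarrow> meets R S \<longrightarrow>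
      (\<forall>T\<in>rects base_drawing. S \<noteq> T \<longrightarrow> R \<noteq> T \<longrightarrow> meets S T \<longrightarrow> \<not> meets R T)"
    by (simp add: base_drawing_def meets_Rect)
  ultimately show False by blast
qed

lemma base_marker_simple:
  assumes "is_clique (intersection_graph (rects base_drawing)) K"
    and "b \<in> set (xmarks base_drawing)" "\<forall>R\<in>K. xmeets b R"
  shows "card K \<le> 1"
proof -
  have "\<forall>b\<in>set (xmarks base_drawing). \<forall>R\<in>rects base_drawing. xmeets b R \<longrightarrow>
      (\<forall>S\<in>rects base_drawing. R \<noteq> S \<longrightarrow> xmeets b S \<longrightarrow> \<not> meets R S)"
    by (simp add: base_drawing_def meets_Rect)
  then have "\<forall>R\<in>K. \<forall>S\<in>K. R = S"
    using assms unfolding is_clique_iff by blast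
  moreover have "finite K"
    using assms(1) finite_subset[of K "rects base_drawing"]
    by (simp add: is_clique_iff base_drawing_def)
  ultimately show ?thesis by (simp add: card_le_Suc0_iff_eq)
qed

text \<open>For a marker of height \<open>t\<close> the first crossbar has total weight
  \<open>4 (8 p + 5 p + 2 u + v)\<close>, where \<open>p\<close>, \<open>u\<close>, \<open>v\<close> are the values of \<open>post_weight t\<close> on the three levels and
  \<open>p = bar_weight t\<close>: this is \<open>13, 13, 20.5, 22\<close> for \<open>t = 3, 11, 21, 27\<close>. Each height occurs at four
  markers, and each marker carries a row and a column, so the total is \<open>8 * 68.5 = 548\<close>.\<close>

lemma alpha_star_rect_family_2: "548 \<le> alpha_star (intersection_graph (rect_family 2))"
proof -
  let ?D = base_drawing
  interpret base: placed_drawing ?D "side ?D + 1"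
    by unfold_locales (rule well_placed_base)
  interpret one: placed_drawing "crossbar ?D" "side (crossbar ?D) + 1"
    by unfold_locales (rule base.well_placed_crossbar)
  have m: "side ?D + 1 = 31" by (simp add: base_marks)
  define w where "w z = base.lift (\<lambda>hor a R. if hor then bar_weight (offset z)
    else post_weight (offset z) (top_edge R))" for z
  define cap where "cap z z' = bar_weight (offset z) + post_weight (offset z) (offset z')" for z z'
  have fin: "finite (rects ?D)" "finite (rects (crossbar ?D))"
    using finite_rect_family[of 0] finite_rect_family[of 1] by (simp_all add: rect_family_def)
  have ne: "base.X \<noteq> {}" by (simp add: base_marks)
  have ne1: "one.X \<noteq> {}" by (simp add: base.crossbar_xmarks base_marks)
  have mark: "\<exists>b t. z = (side ?D + 1) * b + t \<and> b \<in> base.X \<and> t \<in> base.Y \<and> offset z = t"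
    if z_mark: "z \<in> one.X" for z
  proof -
    obtain b t where z: "z = (side ?D + 1) * b + t" "b \<in> base.X" "t \<in> base.Y"
      using z_mark by (auto simp: base.crossbar_xmarks)
    moreover have "offset z = t"
      unfolding z m using base.xmark_bounds[OF z(2)] base.ymark_bounds[OF z(3)] m
      by (intro offset_marker) simp_all
    ultimately show ?thesis by blast
  qed
  have bar: "0 \<le> bar_weight t" "2 * bar_weight t \<le> 1" for t by (simp_all add: bar_weight_def)
  have post: "0 \<le> post_weight t y" "post_weight t y \<le> bar_weight t" for t y
    by (simp_all add: post_weight_def bar_weight_def)
  \<comment> \<open>A base rectangle and the marker heights that meet it lie on the same level.\<close>
  have same_band: "post_weight s (top_edge R) \<le> post_weight s t"
    if "R \<in> rects ?D" "t \<in> base.Y" "ymeets t R" for s t R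
    using that by (auto simp: base_drawing_def post_weight_def)
  have "2 * (\<Sum>z\<in>one.X. sum (w z) (rects (crossbar ?D)))
      \<le> alpha_star (intersection_graph (rects (crossbar (crossbar ?D))))"
  proof (rule one.alpha_star_crossbar_ge[where cap = cap, OF fin(2) ne1])
    show "0 \<le> w z R" if "z \<in> one.X" "R \<in> rects (crossbar ?D)" for z R
      unfolding w_def using that bar post by (intro base.lift_nonneg) auto
  next
    fix z K assume "is_clique (intersection_graph (rects (crossbar ?D))) K"
    then have "sum (w z) K \<le> 2 * bar_weight (offset z)"
      unfolding w_def using bar post
      by (intro base.clique_weight_crossbar_le(1) fin ne base_triangle_free base_marker_simple) auto
    then show "sum (w z) K \<le> 1" using bar(2) by (rule order_trans)
  next
    fix z z' K assume z: "z' \<in> one.X" and K: "is_clique (intersection_graph (rects (crossbar ?D))) K"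
      "\<forall>R\<in>K. xmeets z' R"
    obtain b t where bt: "z' = (side ?D + 1) * b + t" "b \<in> base.X" "t \<in> base.Y" "offset z' = t"
      using mark[OF z] by blast
    show "sum (w z) K \<le> cap z z'"
      unfolding w_def cap_def bt(4)
      by (rule base.clique_weight_crossbar_le(2)[OF fin(1) ne base_triangle_free
            base_marker_simple _ _ K(1) bt(2,3)])
        (use bar post same_band bt K in auto)
  next
    fix z z' assume "z \<in> one.X" "z' \<in> one.X"
    then have "offset z \<in> {3, 11, 21, 27}" "offset z' \<in> {3, 11, 21, 27}"
      using mark base_marks(2) by metis+
    then show "cap z z' + cap z' z \<le> 1"
      unfolding cap_def by (auto simp: bar_weight_def post_weight_def)
  qed
  moreover have "2 * (\<Sum>z\<in>one.X. sum (w z) (rects (crossbar ?D))) = 548"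
  proof -
    \<comment> \<open>Four copies of the base family in each direction, eight rectangles in each.\<close>
    define total where "total t = 4 * (8 * bar_weight t + (\<Sum>R\<in>rects ?D. post_weight t (top_edge R)))" for t
    have "sum (w z) (rects (crossbar ?D)) = total (offset z)" for z
      unfolding w_def base.sum_lift total_def by (simp add: base_marks) (simp add: base_drawing_def)
    then have "(\<Sum>z\<in>one.X. sum (w z) (rects (crossbar ?D))) = (\<Sum>z\<in>one.X. total (offset z))"
      by simp
    also have "\<dots> = (\<Sum>(b, t)\<in>base.X \<times> base.Y. total (offset ((side ?D + 1) * b + t)))"
      unfolding base.crossbar_xmarks by (subst sum.reindex[OF base.inj_on_marks]) (simp add: case_prod_unfold)
    also have "\<dots> = (\<Sum>(b, t)\<in>base.X \<times> base.Y. total t)"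
      unfolding m using base.xmark_bounds(1) base.ymark_bounds(2,4) m
      by (intro sum.cong) (auto simp: offset_marker less_imp_le)
    also have "\<dots> = 4 * (total 3 + total 11 + total 21 + total 27)"
      by (simp add: base_marks sum.cartesian_product[symmetric])
    also have "\<dots> = 274"
      by (simp add: total_def base_drawing_def post_weight_def bar_weight_def)
    finally show ?thesis by simp
  qed
  ultimately show ?thesis by (simp add: rect_family_def numeral_2_eq_2)
qed

theorem proposition13:
  "alpha_star (intersection_graph (rect_family 2)) / real (packing_number (rect_family 2)) \<ge> 137 / 64 \<and>
   (137 / 64 :: real) > 2"
proof -
  let ?a = "alpha_star (intersection_graph (rect_family 2))" and ?n = "real (packing_number (rect_family 2))"
  have "137 / 64 * ?n \<le> 548" "0 < ?n"
    using packing_number_rect_family_2 by simp_all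
  then have "137 / 64 \<le> ?a / ?n"
    using alpha_star_rect_family_2 by (simp add: pos_le_divide_eq)
  then show ?thesis by simp
qed

end
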